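(* Let $n=2$ and let $\ell\ge2$ be an integer. Then the set of all primitive words of length $\ell$ over $\{0,1\}$ forms a single equivalence class with respect to $\sim$ if and only if $2^\ell-1$ is a (Mersenne) prime.
   Context: $\mathcal W$ is the set of all primitive words over $\{0,1\}$ (finite nonempty words that are not of the form $v^k$ with $k\ge2$), of all lengths. For $w=c_0c_1\cdots c_{m-1}\in\mathcal W$ of length $m$, let $$\mathrm h_0(w)=\frac{2^m-1}{\gcd\left(2^m-1,\ \sum_{i=0}^{m-1}c_i2^i\right)}.$$ The equivalence relation $\sim$ on $\mathcal W$ is defined by $w_1\sim w_2\iff\mathrm h_0(w_1)=\mathrm h_0(w_2)$. *)

theory Defs
  imports Main "HOL-Computational_Algebra.Primes"
begin

text \<open>Words over the alphabet \<open>{0,1}\<close> are lists of natural numbers with entries in \<open>{0,1}\<close>.\<close>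

definition primitive :: "nat list \<Rightarrow> bool" where
  "primitive w \<longleftrightarrow> w \<noteq> [] \<and> \<not> (\<exists>v k. k \<ge> 2 \<and> w = concat (replicate k v))"

definition prim_words :: "nat list set" where
  "prim_words = {w. set w \<subseteq> {0, 1} \<and> primitive w}"

text \<open>The division is exact, and the gcd is positive for nonempty \<open>w\<close>. The word \<open>[0]\<close> has
  digit sum \<open>0\<close>, and \<open>gcd a 0 = a\<close> gives it the value \<open>1\<close>.\<close>

definition h0 :: "nat list \<Rightarrow> nat" where
  "h0 w = (2 ^ length w - 1) div gcd (2 ^ length w - 1) (\<Sum>i<length w. w ! i * 2 ^ i)"

definition word_equiv :: "(nat list \<times> nat list) set" where
  "word_equiv = {(w1, w2). w1 \<in> prim_words \<and> w2 \<in> prim_words \<and> h0 w1 = h0 w2}"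

lemma equiv_word_equiv: "equiv prim_words word_equiv"
  by (rule equivI) (auto simp: word_equiv_def refl_on_def sym_def trans_def)

end

theory Submission
  imports Defs "HOL-Number_Theory.Pocklington"
begin

text \<open>For a word \<open>w\<close> of length \<open>m\<close> write \<open>N(w)\<close> for the number with binary digits \<open>w\<close>, least
  significant first. Then \<open>h0 w\<close> is the reduced denominator of \<open>N(w) / (2 ^ m - 1)\<close>, whose binary
  expansion has period \<open>w\<close>. Primitivity of \<open>w\<close> makes \<open>m\<close> the minimal period, that is, the order
  of 2 modulo \<open>h0 w\<close>; hence equivalent words have the same length. The word \<open>10\<dots>0\<close> has
  \<open>h0 = 2 ^ l - 1\<close>. If \<open>2 ^ l - 1\<close> is prime, then so has every primitive word \<open>w\<close> of length \<open>l\<close>, as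
  \<open>0 < N(w) < 2 ^ l - 1\<close>. If \<open>2 ^ l - 1\<close> is composite, take a divisor \<open>p > 1\<close> with
  \<open>p\<^sup>2 \<le> 2 ^ l - 1\<close>: the word of length \<open>l\<close> with value \<open>p\<close> ends in too many zeros to be a proper
  power, and its \<open>h0\<close> is \<open>(2 ^ l - 1) / p\<close>.\<close>

abbreviation bin_val :: "nat list \<Rightarrow> nat" where
  "bin_val w \<equiv> horner_sum id 2 w"

lemma h0_eq: "h0 w = (2 ^ length w - 1) div gcd (2 ^ length w - 1) (bin_val w)"
  by (simp add: h0_def horner_sum_eq_sum atLeast0LessThan)

lemma bin_val_less: "set w \<subseteq> {0, 1} \<Longrightarrow> bin_val w < 2 ^ length w"
  by (induction w) auto

lemma bin_val_replicate_0: "bin_val (replicate n 0) = 0"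
  by (induction n) auto

lemma Suc_bin_val_replicate_1: "Suc (bin_val (replicate n 1)) = 2 ^ n"
  by (induction n) auto

lemma bin_val_inj:
  assumes "set v \<subseteq> {0, 1}" "set w \<subseteq> {0, 1}" "length v = length w" "bin_val v = bin_val w"
  shows "v = w"
  using assms(3,1,2,4)
proof (induction v w rule: list_induct2)
  case (Cons x xs y ys)
  then have "x = y"
    by (auto dest: arg_cong[where f = even])
  with Cons show ?case
    by simp
qed simp

lemma bin_val_surj:
  assumes "c < 2 ^ m"
  obtains w where "set w \<subseteq> {0, 1}" "length w = m" "bin_val w = c"
  using assms
proof (induction m arbitrary: c thesis)
  case (Suc m)
  have "c div 2 < 2 ^ m"
    using Suc.prems(2) by (simp add: less_mult_imp_div_less)
  then obtain w where "set w \<subseteq> {0, 1}" "length w = m" "bin_val w = c div 2"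
    using Suc.IH by blast
  then show ?case
    by (intro Suc.prems(1)[of "c mod 2 # w"]) (auto simp: id_def)
qed simp

text \<open>Repetition sums a geometric series with ratio \<open>2 ^ length v\<close>; clearing its
  denominator avoids division.\<close>

lemma bin_val_power:
  "bin_val (concat (replicate k v)) * (2 ^ length v - 1) = bin_val v * (2 ^ (k * length v) - 1)"
proof (induction k)
  case (Suc k)
  let ?a = "2 ^ length v :: nat" and ?b = "2 ^ (k * length v) :: nat"
  have "?a \<ge> 1" "?b \<ge> 1"
    by simp_all
  then have "bin_val v * (?a - 1) + ?a * (bin_val v * (?b - 1)) = bin_val v * (?a * ?b - 1)"
    by (auto simp: algebra_simps diff_mult_distrib2 dest!: le_Suc_ex)
  with Suc show ?case
    by (simp add: horner_sum_append power_add algebra_simps)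
qed simp

lemma length_concat_replicate: "length (concat (replicate k v)) = k * length v"
  by (induction k) auto

lemma length_eq_ord_h0:
  assumes "w \<in> prim_words"
  shows "length w = ord (h0 w) 2"
proof (rule ccontr)
  assume neq: "length w \<noteq> ord (h0 w) 2"
  define m where "m = length w"
  define M where "M = (2 ^ m - 1 :: nat)"
  define d where "d = h0 w"
  define g where "g = ord d 2"
  have bits: "set w \<subseteq> {0, 1}" and "primitive w"
    using assms by (auto simp: prim_words_def)
  then have "m > 0"
    by (simp add: m_def primitive_def)
  then have "M > 0"
    using one_less_power[of "2 :: nat" m] by (simp add: M_def)
  have d: "M = d * gcd M (bin_val w)"
    by (simp add: d_def h0_eq M_def m_def)
  then have "d dvd M"
    by (metis dvd_triv_left)
  have dvd_iff: "d dvd 2 ^ n - 1 \<longleftrightarrow> g dvd n" for n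
    unfolding g_def ord_divides[symmetric] by (rule cong_altdef_nat[symmetric]) simp
  then have "g dvd m"
    using \<open>d dvd M\<close> by (simp add: M_def)
  then obtain k where k: "m = g * k" ..
  \<comment> \<open>\<open>k = 0\<close> would make \<open>w\<close> empty, and \<open>k = 1\<close>
    would make its length the order.\<close>
  have "k \<ge> 2"
    using k \<open>m > 0\<close> neq by (cases k; cases "k - 1") (auto simp: m_def g_def d_def)
  have "g > 0"
    using k \<open>m > 0\<close> by (cases g) auto
  define G where "G = (2 ^ g - 1 :: nat)"
  have "G > 0"
    using \<open>g > 0\<close> one_less_power[of "2 :: nat" g] by (simp add: G_def)
  obtain e where e: "G = d * e"
    using dvd_iff[of g] by (auto simp: G_def)
  obtain f where f: "bin_val w = gcd M (bin_val w) * f"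
    by (meson dvd_def gcd_dvd2)
  \<comment> \<open>In lowest terms \<open>bin_val w / M\<close> is \<open>f / d\<close>. Since
    \<open>G = d * e\<close>, its numerator over \<open>G\<close> is \<open>e * f\<close>, which
    supplies the digits of the shorter period \<open>v\<close>.\<close>
  have val: "bin_val w * G = e * f * M"
    using f d e by (metis mult.assoc mult.commute)
  have "bin_val w \<le> M"
    using bin_val_less[OF bits] by (simp add: M_def m_def)
  then have "e * f * M \<le> G * M"
    using val by (metis mult.commute mult_le_mono1)
  \<comment> \<open>Even the value \<open>G\<close>, all ones, fits into \<open>g\<close> digits, so
    the non-strict bound is enough.\<close>
  then have "e * f < 2 ^ g"
    using \<open>M > 0\<close> \<open>G > 0\<close> by (simp add: G_def)
  then obtain v where v: "set v \<subseteq> {0, 1}" "length v = g" "bin_val v = e * f"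
    by (rule bin_val_surj)
  let ?u = "concat (replicate k v)"
  have "bin_val ?u * G = bin_val w * G"
    using bin_val_power[of k v] v val by (simp add: G_def M_def k mult.commute)
  then have "bin_val ?u = bin_val w"
    using \<open>G > 0\<close> by simp
  then have "?u = w"
    using v bits by (intro bin_val_inj) (auto simp: length_concat_replicate k m_def[symmetric])
  then show False
    using \<open>primitive w\<close> \<open>k \<ge> 2\<close> unfolding primitive_def by metis
qed

text \<open>With L the length of \<open>w\<close>, a proper power of a word of length m has 2 * m
  \<le> L, and its value is a multiple of (2^L - 1) / (2^m - 1). If positive, it exceeds 2^(L - m),
  so its square exceeds 2^L.\<close>

lemma primitive_if_bin_val_small:
  assumes "0 < bin_val w" "(bin_val w)\<^sup>2 < 2 ^ length w"
  shows "primitive w"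
  unfolding primitive_def
proof (intro conjI notI)
  assume "\<exists>v k. 2 \<le> k \<and> w = concat (replicate k v)"
  then obtain v k where k: "2 \<le> k" and w: "w = concat (replicate k v)"
    by blast
  define m where "m = length v"
  define a where "a = bin_val w"
  have eq: "a * (2 ^ m - 1) = bin_val v * (2 ^ length w - 1)"
    using bin_val_power[of k v] by (simp add: w a_def m_def length_concat_replicate)
  have "m > 0"
    using assms(1) by (auto simp: w m_def)
  then have "a * (2 ^ m - 1) > 0"
    using assms(1) one_less_power[of "2 :: nat" m] by (simp add: a_def)
  then have "bin_val v > 0"
    using eq by (cases "bin_val v") auto
  then have le: "2 ^ length w - 1 \<le> a * (2 ^ m - 1)"
    using eq by simp
  have "2 * m \<le> length w"
    using k by (simp add: w length_concat_replicate m_def)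
  then have "(2 ^ m)\<^sup>2 \<le> (2 ^ length w :: nat)"
    by (simp flip: power_mult add: mult.commute)
  then have "a\<^sup>2 * (2 ^ m)\<^sup>2 < 2 ^ length w * 2 ^ length w"
    using assms(2) by (intro mult_less_le_imp_less) (auto simp: a_def)
  then have "(a * 2 ^ m)\<^sup>2 < (2 ^ length w)\<^sup>2"
    by (simp add: power2_eq_square algebra_simps)
  then have "a * 2 ^ m < 2 ^ length w"
    by (rule power_less_imp_less_base) simp
  \<comment> \<open>This keeps the natural subtraction \<open>a * 2 ^ m - a\<close> exact; as
    \<open>a > 0\<close>, the result lies below \<open>2 ^ length w - 1\<close>, against
    \<open>le\<close>.\<close>
  moreover have "a \<le> a * 2 ^ m"
    by simp
  ultimately show False
    using le assms(1) unfolding a_def diff_mult_distrib2 mult_1_right by linarith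
qed (use assms(1) in auto)

lemma replicate_not_primitive: "n \<ge> 2 \<Longrightarrow> \<not> primitive (replicate n x)"
  unfolding primitive_def by (auto intro!: exI[of _ "[x]"] exI[of _ n])

lemma h0_eq_if_prime:
  assumes "w \<in> prim_words" "length w \<ge> 2" and prime: "prime (2 ^ length w - 1 :: nat)"
  shows "h0 w = 2 ^ length w - 1"
proof -
  have bits: "set w \<subseteq> {0, 1}" and "primitive w"
    using assms by (auto simp: prim_words_def)
  \<comment> \<open>The constant words carry the only two values below \<open>2 ^ length w\<close>
    that \<open>2 ^ length w - 1\<close> divides.\<close>
  then have "w \<noteq> replicate (length w) 0" "w \<noteq> replicate (length w) 1"
    using replicate_not_primitive[OF assms(2)] by metis+
  then have "bin_val w \<noteq> 0" "bin_val w \<noteq> 2 ^ length w - 1"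
    using bits bin_val_inj[of w "replicate (length w) 0"] bin_val_inj[of w "replicate (length w) 1"]
      bin_val_replicate_0[of "length w"] Suc_bin_val_replicate_1[of "length w"]
    by (fastforce simp: set_replicate_conv_if split: if_splits)+
  moreover from this have "bin_val w < 2 ^ length w - 1"
    using bin_val_less[OF bits] by linarith
  ultimately have "\<not> 2 ^ length w - 1 dvd bin_val w"
    by (simp add: nat_dvd_not_less)
  then have "coprime (2 ^ length w - 1) (bin_val w)"
    by (rule prime_imp_coprime[OF prime])
  then show ?thesis
    by (simp add: h0_eq)
qed

lemma ex_prim_word_h0_max:
  assumes "l \<ge> 2"
  obtains w where "w \<in> prim_words" "length w = l" "h0 w = 2 ^ l - 1"
proof -
  let ?w = "1 # replicate (l - 1) (0 :: nat)"
  have "bin_val ?w = 1"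
    by (simp add: bin_val_replicate_0)
  moreover have "(1 :: nat) < 2 ^ l"
    using assms one_less_power[of "2 :: nat" l] by simp
  ultimately show ?thesis
    using assms by (intro that[of ?w])
      (auto simp: prim_words_def h0_eq intro!: primitive_if_bin_val_small)
qed

theorem proposition6p1:
  fixes l :: nat
  assumes "l \<ge> 2"
  shows "{w \<in> prim_words. length w = l} \<in> prim_words // word_equiv \<longleftrightarrow> prime (2 ^ l - 1 :: nat)"
proof
  let ?S = "{w \<in> prim_words. length w = l}"
  obtain u where u: "u \<in> prim_words" "length u = l" "h0 u = 2 ^ l - 1"
    using ex_prim_word_h0_max[OF assms] .
  show "prime (2 ^ l - 1 :: nat)" if "?S \<in> prim_words // word_equiv"
  proof (rule ccontr)
    assume "\<not> prime (2 ^ l - 1 :: nat)"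
    \<comment> \<open>This gives \<open>2 ^ l - 1 > 1\<close>, so that a non-prime value has a prime
      factor up to its square root.\<close>
    moreover have l: "(2 :: nat) ^ 2 \<le> 2 ^ l"
      using assms by (intro power_increasing) auto
    ultimately obtain p :: nat where p: "prime p" "p dvd 2 ^ l - 1" "p\<^sup>2 \<le> 2 ^ l - 1"
      using prime_prime_factor_sqrt[of "2 ^ l - 1"] by auto
    have "p\<^sup>2 < 2 ^ l"
      using p(3) by (rule le_less_trans) simp
    moreover have "p \<le> p\<^sup>2"
      by (simp add: power2_eq_square)
    ultimately obtain w where w: "set w \<subseteq> {0, 1}" "length w = l" "bin_val w = p"
      using bin_val_surj[of p l] by (metis order.strict_trans1)
    then have "w \<in> prim_words"
      using \<open>p\<^sup>2 < 2 ^ l\<close> assms prime_gt_0_nat[OF p(1)]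
      by (auto simp: prim_words_def intro!: primitive_if_bin_val_small)
    then have "(u, w) \<in> word_equiv"
      using u w by (intro in_quotient_imp_in_rel[OF equiv_word_equiv that]) simp
    then have "2 ^ l - 1 = (2 ^ l - 1) div p"
      using u w p(2) by (simp add: word_equiv_def h0_eq gcd_nat.absorb2)
    moreover have "(2 ^ l - 1) div p < 2 ^ l - 1"
      using l prime_gt_1_nat[OF p(1)] by (intro div_less_dividend) auto
    ultimately show False
      by simp
  qed
  show "?S \<in> prim_words // word_equiv" if "prime (2 ^ l - 1 :: nat)"
  proof -
    \<comment> \<open>The class of \<open>u\<close> ranges over words of all lengths, so other
      lengths must be excluded too; there the order of 2 modulo \<open>h0 u\<close> decides.\<close>
    have "length w = l \<longleftrightarrow> h0 w = h0 u" if w: "w \<in> prim_words" for w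
    proof
      show "h0 w = h0 u" if "length w = l"
        using h0_eq_if_prime[OF w] that u(3) assms \<open>prime (2 ^ l - 1)\<close> by simp
      show "length w = l" if "h0 w = h0 u"
        using length_eq_ord_h0[OF w] length_eq_ord_h0[OF u(1)] that u(2) by metis
    qed
    then have "?S = word_equiv `` {u}"
      unfolding word_equiv_def using u(1) by fastforce
    then show ?thesis
      using u by (auto intro: quotientI)
  qed
qed

end
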